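(* Let $M$ be a finitely generated right coherent monoid, let $A$ be an $M$-act and let $B$ be a large subact of $A$ (i.e. a subact with $A\setminus B$ finite). If $A$ is finitely presented, then $B$ is finitely presented.
   Context: Let $M$ be a monoid with identity $1$. A (right) $M$-act is a non-empty set $A$ with a map $A\times M\to A$, $(a,m)\mapsto am$, with $a(mn)=(am)n$ and $a1=a$. A subact of $A$ is a non-empty subset $B$ with $bm\in B$ for all $b\in B$, $m\in M$. A subset $U$ generates $A$ if every $a\in A$ is $um$ for some $u\in U$, $m\in M$; $A$ is finitely generated if it has a finite generating set. A congruence on $A$ is an equivalence relation $\rho$ with $(a,b)\in\rho\Rightarrow(am,bm)\in\rho$ for all $m\in M$. For a set $X$, $F_X=X\times M$ is the free $M$-act with $(x,m)n=(x,mn)$. A presentation $\langle X\,|\,R\rangle$ consists of a non-empty set $X$ and a set $R\subseteq F_X\times F_X$; an $M$-act is defined by it if it is isomorphic to $F_X/\rho$, where $\rho$ is the smallest congruence on $F_X$ containing $R$. An $M$-act is finitely presented if it is defined by some presentation $\langle X\,|\,R\rangle$ with $X$ and $R$ finite. A monoid $M$ is right coherent if every finitely generated subact of every finitely presented $M$-act is finitely presented. *)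

theory Defs
  imports "HOL-Algebra.Group"
begin

section \<open>Acts over a monoid\<close>

text \<open>The library has \<^locale>\<open>submonoid\<close> but no generated submonoid
  (its \<open>generate\<close> closes under inverses).\<close>

definition fg_monoid :: "('m, 'r) monoid_scheme \<Rightarrow> bool" where
  "fg_monoid M \<longleftrightarrow> (\<exists>S. finite S \<and> S \<subseteq> carrier M \<and>
     (\<forall>H. submonoid H M \<and> S \<subseteq> H \<longrightarrow> H = carrier M))"

locale right_act = monoid M
  for M :: "('m, 'r) monoid_scheme" (structure) +
  fixes A :: "'a set" and act :: "'a \<Rightarrow> 'm \<Rightarrow> 'a"
  assumes nonempty: "A \<noteq> {}"
    and act_closed: "\<lbrakk>a \<in> A; m \<in> carrier M\<rbrakk> \<Longrightarrow> act a m \<in> A"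
    and act_mult: "\<lbrakk>a \<in> A; m \<in> carrier M; n \<in> carrier M\<rbrakk> \<Longrightarrow> act a (m \<otimes> n) = act (act a m) n"
    and act_one: "a \<in> A \<Longrightarrow> act a \<one> = a"

definition subact ::
    "('m, 'r) monoid_scheme \<Rightarrow> 'a set \<Rightarrow> ('a \<Rightarrow> 'm \<Rightarrow> 'a) \<Rightarrow> 'a set \<Rightarrow> bool" where
  "subact M A act B \<longleftrightarrow> B \<subseteq> A \<and> B \<noteq> {} \<and> (\<forall>b\<in>B. \<forall>m\<in>carrier M. act b m \<in> B)"

definition large_subact ::
    "('m, 'r) monoid_scheme \<Rightarrow> 'a set \<Rightarrow> ('a \<Rightarrow> 'm \<Rightarrow> 'a) \<Rightarrow> 'a set \<Rightarrow> bool" where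
  "large_subact M A act B \<longleftrightarrow> subact M A act B \<and> finite (A - B)"

definition generates_act ::
    "('m, 'r) monoid_scheme \<Rightarrow> 'a set \<Rightarrow> ('a \<Rightarrow> 'm \<Rightarrow> 'a) \<Rightarrow> 'a set \<Rightarrow> bool" where
  "generates_act M A act U \<longleftrightarrow> U \<subseteq> A \<and> (\<forall>a\<in>A. \<exists>u\<in>U. \<exists>m\<in>carrier M. a = act u m)"

definition fg_act :: "('m, 'r) monoid_scheme \<Rightarrow> 'a set \<Rightarrow> ('a \<Rightarrow> 'm \<Rightarrow> 'a) \<Rightarrow> bool" where
  "fg_act M A act \<longleftrightarrow> (\<exists>U. finite U \<and> generates_act M A act U)"

definition act_congruence ::
    "('m, 'r) monoid_scheme \<Rightarrow> 'a set \<Rightarrow> ('a \<Rightarrow> 'm \<Rightarrow> 'a) \<Rightarrow> ('a \<times> 'a) set \<Rightarrow> bool" where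
  "act_congruence M A act \<rho> \<longleftrightarrow> equiv A \<rho> \<and>
     (\<forall>a b m. (a, b) \<in> \<rho> \<and> m \<in> carrier M \<longrightarrow> (act a m, act b m) \<in> \<rho>)"

text \<open>Intended for \<open>R \<subseteq> A \<times> A\<close>; otherwise the intersection is over the empty family.\<close>

definition gen_congruence ::
    "('m, 'r) monoid_scheme \<Rightarrow> 'a set \<Rightarrow> ('a \<Rightarrow> 'm \<Rightarrow> 'a) \<Rightarrow> ('a \<times> 'a) set \<Rightarrow> ('a \<times> 'a) set" where
  "gen_congruence M A act R = \<Inter>{\<rho>. act_congruence M A act \<rho> \<and> R \<subseteq> \<rho>}"

text \<open>The quotient act has carrier \<open>A // \<rho>\<close>. Its action maps the class of \<open>a\<close> to the class
  of \<open>act a m\<close>; see \<open>quot_op_class\<close> below.\<close>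

definition quot_op ::
    "('a \<Rightarrow> 'm \<Rightarrow> 'a) \<Rightarrow> ('a \<times> 'a) set \<Rightarrow> 'a set \<Rightarrow> 'm \<Rightarrow> 'a set" where
  "quot_op act \<rho> C m = \<rho> `` ((\<lambda>a. act a m) ` C)"

definition act_iso ::
    "('m, 'r) monoid_scheme \<Rightarrow> 'a set \<Rightarrow> ('a \<Rightarrow> 'm \<Rightarrow> 'a) \<Rightarrow> 'b set \<Rightarrow> ('b \<Rightarrow> 'm \<Rightarrow> 'b) \<Rightarrow>
     ('a \<Rightarrow> 'b) \<Rightarrow> bool" where
  "act_iso M A act A' act' \<phi> \<longleftrightarrow> bij_betw \<phi> A A' \<and>
     (\<forall>a\<in>A. \<forall>m\<in>carrier M. \<phi> (act a m) = act' (\<phi> a) m)"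

definition free_carrier :: "('m, 'r) monoid_scheme \<Rightarrow> 'x set \<Rightarrow> ('x \<times> 'm) set" where
  "free_carrier M X = X \<times> carrier M"

definition free_op :: "('m, 'r) monoid_scheme \<Rightarrow> 'x \<times> 'm \<Rightarrow> 'm \<Rightarrow> 'x \<times> 'm" where
  "free_op M p n = (fst p, snd p \<otimes>\<^bsub>M\<^esub> n)"

definition pres_cong ::
    "('m, 'r) monoid_scheme \<Rightarrow> 'x set \<Rightarrow> (('x \<times> 'm) \<times> ('x \<times> 'm)) set \<Rightarrow>
     (('x \<times> 'm) \<times> ('x \<times> 'm)) set" where
  "pres_cong M X R = gen_congruence M (free_carrier M X) (free_op M) R"

definition presentation ::
    "('m, 'r) monoid_scheme \<Rightarrow> 'x set \<Rightarrow> (('x \<times> 'm) \<times> ('x \<times> 'm)) set \<Rightarrow> bool" where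
  "presentation M X R \<longleftrightarrow> X \<noteq> {} \<and> R \<subseteq> free_carrier M X \<times> free_carrier M X"

definition defined_by ::
    "('m, 'r) monoid_scheme \<Rightarrow> 'a set \<Rightarrow> ('a \<Rightarrow> 'm \<Rightarrow> 'a) \<Rightarrow>
     'x set \<Rightarrow> (('x \<times> 'm) \<times> ('x \<times> 'm)) set \<Rightarrow> bool" where
  "defined_by M A act X R \<longleftrightarrow> presentation M X R \<and>
     (\<exists>\<phi>. act_iso M A act (free_carrier M X // pres_cong M X R)
            (quot_op (free_op M) (pres_cong M X R)) \<phi>)"

text \<open>HOL cannot quantify over the type of the generating symbols; since only finite sets of
  generators matter, natural numbers suffice as symbols. Lemma \<open>fp_act_any_type\<close> below shows
  that finite presentations over any other type give nothing new.\<close>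

definition fp_act :: "('m, 'r) monoid_scheme \<Rightarrow> 'a set \<Rightarrow> ('a \<Rightarrow> 'm \<Rightarrow> 'a) \<Rightarrow> bool" where
  "fp_act M A act \<longleftrightarrow> (\<exists>(X :: nat set) R. finite X \<and> finite R \<and> defined_by M A act X R)"

text \<open>Likewise the acts quantified over have elements in one fixed type, that of the elements
  of the quotients of free acts over sets of natural numbers. This type contains an isomorphic
  copy of every finitely presented act; lemma \<open>right_coherent_any_type\<close> below shows that
  coherence then holds for acts on every type.\<close>

definition right_coherent :: "('m, 'r) monoid_scheme \<Rightarrow> bool" where
  "right_coherent M \<longleftrightarrow>
     (\<forall>(A :: (nat \<times> 'm) set set) act B.
        right_act M A act \<and> fp_act M A act \<and> subact M A act B \<and> fg_act M B act
          \<longrightarrow> fp_act M B act)"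


section \<open>Adequacy of the definitions\<close>

lemma act_iso_comp:
  assumes "act_iso M A act A' act' \<phi>" "act_iso M A' act' A'' act'' \<psi>"
  shows "act_iso M A act A'' act'' (\<psi> \<circ> \<phi>)"
  using assms unfolding act_iso_def
  by (auto intro: bij_betw_trans dest: bij_betwE)

lemma act_iso_inv:
  assumes "act_iso M A act A' act' \<phi>" and "right_act M A act"
  shows "act_iso M A' act' A act (inv_into A \<phi>)"
proof -
  interpret right_act M A act by fact
  have b: "bij_betw \<phi> A A'" and e: "\<And>a m. a \<in> A \<Longrightarrow> m \<in> carrier M \<Longrightarrow> \<phi> (act a m) = act' (\<phi> a) m"
    using assms(1) unfolding act_iso_def by auto
  have "inv_into A \<phi> (act' x m) = act (inv_into A \<phi> x) m" if x: "x \<in> A'" and m: "m \<in> carrier M" for x m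
  proof -
    obtain a where a: "a \<in> A" "x = \<phi> a" using b x unfolding bij_betw_def by blast
    show ?thesis
      using a b m act_closed e[symmetric] by (simp add: bij_betw_inv_into_left)
  qed
  then show ?thesis using b unfolding act_iso_def by (simp add: bij_betw_inv_into)
qed

lemma right_act_free:
  assumes "monoid M" "X \<noteq> {}"
  shows "right_act M (free_carrier M X) (free_op M)"
proof -
  interpret monoid M by fact
  show ?thesis
    by unfold_locales (use assms(2) in \<open>auto simp: free_carrier_def free_op_def m_assoc\<close>)
qed

lemma act_congruence_gen:
  assumes "right_act M A act" "R \<subseteq> A \<times> A"
  shows "act_congruence M A act (gen_congruence M A act R)" "R \<subseteq> gen_congruence M A act R"
proof -
  interpret right_act M A act by fact
  let ?S = "{\<rho>. act_congruence M A act \<rho> \<and> R \<subseteq> \<rho>}"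
  have "act_congruence M A act (A \<times> A)"
    unfolding act_congruence_def equiv_def refl_on_def sym_def trans_def by (auto intro: act_closed)
  then have full: "A \<times> A \<in> ?S" using assms(2) by blast
  have "equiv A (\<Inter>?S)"
  proof (rule equivI)
    show "\<Inter>?S \<subseteq> A \<times> A" using full by blast
    show "refl_on A (\<Inter>?S)"
      by (auto simp: refl_on_def act_congruence_def equiv_def)
    have st: "sym \<rho>" "trans \<rho>" if "\<rho> \<in> ?S" for \<rho>
      using that by (simp_all add: act_congruence_def equiv_def)
    show "sym (\<Inter>?S)"
      by (rule symI, rule InterI) (use st(1) in \<open>blast dest: symD\<close>)
    show "trans (\<Inter>?S)"
    proof (rule transI, rule InterI)
      fix x y z \<rho> assume "(x, y) \<in> \<Inter>?S" "(y, z) \<in> \<Inter>?S" and \<rho>: "\<rho> \<in> ?S"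
      then have "(x, y) \<in> \<rho>" "(y, z) \<in> \<rho>" by blast+
      then show "(x, z) \<in> \<rho>" using st(2)[OF \<rho>] by (rule transD[rotated])
    qed
  qed
  moreover have "(act a m, act b m) \<in> \<Inter>?S" if ab: "(a, b) \<in> \<Inter>?S" and m: "m \<in> carrier M" for a b m
  proof (rule InterI)
    fix \<rho> assume \<rho>: "\<rho> \<in> ?S"
    then have "(a, b) \<in> \<rho>" using ab by (rule InterD[rotated])
    then show "(act a m, act b m) \<in> \<rho>" using \<rho> m by (simp add: act_congruence_def)
  qed
  ultimately show "act_congruence M A act (gen_congruence M A act R)"
    unfolding gen_congruence_def act_congruence_def[of M A act "\<Inter>?S"] by blast
  show "R \<subseteq> gen_congruence M A act R"
    unfolding gen_congruence_def by blast
qed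

lemma gen_congruence_least:
  "\<lbrakk>act_congruence M A act \<rho>; R \<subseteq> \<rho>\<rbrakk> \<Longrightarrow> gen_congruence M A act R \<subseteq> \<rho>"
  unfolding gen_congruence_def by blast

lemma quot_op_class:
  assumes "act_congruence M A act \<rho>" "a \<in> A" "m \<in> carrier M"
  shows "quot_op act \<rho> (\<rho> `` {a}) m = \<rho> `` {act a m}"
proof -
  have eq: "equiv A \<rho>" and c: "\<And>a b. (a, b) \<in> \<rho> \<Longrightarrow> (act a m, act b m) \<in> \<rho>"
    using assms(1,3) unfolding act_congruence_def by auto
  have "(a, a) \<in> \<rho>" using eq assms(2) by (auto simp: equiv_def refl_on_def)
  moreover have "\<And>b. (a, b) \<in> \<rho> \<Longrightarrow> \<rho> `` {act b m} = \<rho> `` {act a m}"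
    using c eq equiv_class_eq by fastforce
  ultimately show ?thesis unfolding quot_op_def by blast
qed

lemma right_act_quot:
  assumes "right_act M A act" "act_congruence M A act \<rho>"
  shows "right_act M (A // \<rho>) (quot_op act \<rho>)"
proof -
  interpret right_act M A act by fact
  note q = quot_op_class[OF assms(2)]
  show ?thesis
  proof unfold_locales
    show "A // \<rho> \<noteq> {}" using nonempty by (simp add: quotient_def)
  next
    fix C m assume "C \<in> A // \<rho>" "m \<in> carrier M"
    then show "quot_op act \<rho> C m \<in> A // \<rho>"
      by (auto elim!: quotientE simp: q intro!: quotientI act_closed)
  next
    fix C m n assume "C \<in> A // \<rho>" "m \<in> carrier M" "n \<in> carrier M"
    then show "quot_op act \<rho> C (m \<otimes>\<^bsub>M\<^esub> n) = quot_op act \<rho> (quot_op act \<rho> C m) n"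
      by (auto elim!: quotientE simp: q act_closed act_mult)
  next
    fix C assume "C \<in> A // \<rho>"
    then show "quot_op act \<rho> C \<one>\<^bsub>M\<^esub> = C"
      by (auto elim!: quotientE simp: q act_one)
  qed
qed

lemma act_congruence_pullback:
  assumes "right_act M A act" "act_congruence M A' act' \<rho>"
    and "\<And>a. a \<in> A \<Longrightarrow> g a \<in> A'"
    and "\<And>a m. a \<in> A \<Longrightarrow> m \<in> carrier M \<Longrightarrow> g (act a m) = act' (g a) m"
  shows "act_congruence M A act {(a, b). a \<in> A \<and> b \<in> A \<and> (g a, g b) \<in> \<rho>}"
proof -
  interpret right_act M A act by fact
  let ?P = "{(a, b). a \<in> A \<and> b \<in> A \<and> (g a, g b) \<in> \<rho>}"
  have r: "refl_on A' \<rho>" "sym \<rho>" "trans \<rho>"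
    using assms(2) unfolding act_congruence_def equiv_def by auto
  have "equiv A ?P"
  proof (rule equivI)
    show "refl_on A ?P" using r(1) assms(3) by (auto simp: refl_on_def)
    show "sym ?P" using r(2) unfolding sym_def by blast
    show "trans ?P" using r(3) unfolding trans_def by blast
  qed auto
  then show ?thesis
    using assms(2,4) act_closed unfolding act_congruence_def by auto
qed

lemma quotient_iso:
  assumes A: "right_act M A act" and A': "right_act M A' act'"
    and iso: "act_iso M A act A' act' \<phi>" and R: "R \<subseteq> A \<times> A"
  defines "\<rho> \<equiv> gen_congruence M A act R"
    and "\<rho>' \<equiv> gen_congruence M A' act' (map_prod \<phi> \<phi> ` R)"
  shows "act_iso M (A // \<rho>) (quot_op act \<rho>) (A' // \<rho>') (quot_op act' \<rho>') ((`) \<phi>)"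
proof -
  interpret right_act M A act by fact
  have b: "bij_betw \<phi> A A'" and e: "\<And>a m. a \<in> A \<Longrightarrow> m \<in> carrier M \<Longrightarrow> \<phi> (act a m) = act' (\<phi> a) m"
    using iso unfolding act_iso_def by auto
  have mem: "\<And>a. a \<in> A \<Longrightarrow> \<phi> a \<in> A'" using b by (auto dest: bij_betwE)
  have R': "map_prod \<phi> \<phi> ` R \<subseteq> A' \<times> A'" using R mem by auto
  note C = act_congruence_gen[OF A R, folded \<rho>_def]
  note C' = act_congruence_gen[OF A' R', folded \<rho>'_def]
  have sub: "\<rho> \<subseteq> A \<times> A" "\<rho>' \<subseteq> A' \<times> A'"
    using C(1) C'(1) by (auto simp: act_congruence_def equiv_def)
  define g where "g = inv_into A \<phi>"
  have gi: "act_iso M A' act' A act g" unfolding g_def by (rule act_iso_inv[OF iso A])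
  have gl: "\<And>a. a \<in> A \<Longrightarrow> g (\<phi> a) = a" unfolding g_def using b by (rule bij_betw_inv_into_left)
  have "\<rho> \<subseteq> {(x, y). x \<in> A \<and> y \<in> A \<and> (\<phi> x, \<phi> y) \<in> \<rho>'}"
    unfolding \<rho>_def
  proof (rule gen_congruence_least)
    show "act_congruence M A act {(x, y). x \<in> A \<and> y \<in> A \<and> (\<phi> x, \<phi> y) \<in> \<rho>'}"
      by (rule act_congruence_pullback[where g = \<phi>, OF A C'(1)]) (fact mem e)+
    show "R \<subseteq> {(x, y). x \<in> A \<and> y \<in> A \<and> (\<phi> x, \<phi> y) \<in> \<rho>'}"
      using R C'(2) by force
  qed
  then have fwd: "\<And>x y. (x, y) \<in> \<rho> \<Longrightarrow> (\<phi> x, \<phi> y) \<in> \<rho>'" by auto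
  have "\<rho>' \<subseteq> {(x, y). x \<in> A' \<and> y \<in> A' \<and> (g x, g y) \<in> \<rho>}"
    unfolding \<rho>'_def
  proof (rule gen_congruence_least)
    show "act_congruence M A' act' {(x, y). x \<in> A' \<and> y \<in> A' \<and> (g x, g y) \<in> \<rho>}"
    proof (rule act_congruence_pullback[where g = g, OF A' C(1)])
      show "\<And>a. a \<in> A' \<Longrightarrow> g a \<in> A" using gi by (auto simp: act_iso_def dest: bij_betwE)
      show "\<And>a m. a \<in> A' \<Longrightarrow> m \<in> carrier M \<Longrightarrow> g (act' a m) = act (g a) m"
        using gi by (auto simp: act_iso_def)
    qed
    show "map_prod \<phi> \<phi> ` R \<subseteq> {(x, y). x \<in> A' \<and> y \<in> A' \<and> (g x, g y) \<in> \<rho>}"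
    proof
      fix z assume "z \<in> map_prod \<phi> \<phi> ` R"
      then obtain x y where xy: "(x, y) \<in> R" "z = (\<phi> x, \<phi> y)" by auto
      then have "x \<in> A" "y \<in> A" using R by auto
      then show "z \<in> {(x, y). x \<in> A' \<and> y \<in> A' \<and> (g x, g y) \<in> \<rho>}"
        using xy C(2) mem gl by auto
    qed
  qed
  then have bwd: "\<And>x y. x \<in> A \<Longrightarrow> y \<in> A \<Longrightarrow> (\<phi> x, \<phi> y) \<in> \<rho>' \<Longrightarrow> (x, y) \<in> \<rho>"
    using gl by force
  have cls: "\<phi> ` (\<rho> `` {a}) = \<rho>' `` {\<phi> a}" if "a \<in> A" for a
  proof
    show "\<phi> ` (\<rho> `` {a}) \<subseteq> \<rho>' `` {\<phi> a}" using fwd by auto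
    show "\<rho>' `` {\<phi> a} \<subseteq> \<phi> ` (\<rho> `` {a})"
    proof
      fix y assume y: "y \<in> \<rho>' `` {\<phi> a}"
      then have "y \<in> A'" using sub(2) by auto
      then obtain x where "x \<in> A" "y = \<phi> x" using b unfolding bij_betw_def by blast
      then show "y \<in> \<phi> ` (\<rho> `` {a})" using y bwd that by auto
    qed
  qed
  have "bij_betw ((`) \<phi>) (A // \<rho>) (A' // \<rho>')"
    unfolding bij_betw_def
  proof
    have "A // \<rho> \<subseteq> Pow A" using sub(1) by (auto simp: quotient_def)
    then show "inj_on ((`) \<phi>) (A // \<rho>)"
      using b unfolding bij_betw_def by (meson inj_on_image_Pow inj_on_subset)
    have "A' // \<rho>' = (\<lambda>a. \<rho>' `` {a}) ` (\<phi> ` A)"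
      using b by (auto simp: quotient_def bij_betw_def)
    also have "\<dots> = (\<lambda>a. \<phi> ` (\<rho> `` {a})) ` A"
      by (simp add: image_image cls)
    also have "\<dots> = (`) \<phi> ` (A // \<rho>)"
      by (auto simp: quotient_def)
    finally show "(`) \<phi> ` (A // \<rho>) = A' // \<rho>'" by simp
  qed
  moreover have "\<phi> ` quot_op act \<rho> D m = quot_op act' \<rho>' (\<phi> ` D) m"
    if D: "D \<in> A // \<rho>" and m: "m \<in> carrier M" for D m
  proof -
    obtain a where a: "a \<in> A" "D = \<rho> `` {a}" using D by (rule quotientE)
    show ?thesis
      using a m by (simp add: quot_op_class[OF C(1)] quot_op_class[OF C'(1)] cls mem e act_closed)
  qed
  ultimately show ?thesis unfolding act_iso_def by auto
qed

lemma fp_act_iso: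
  assumes "fp_act M A' act'" "act_iso M A act A' act' \<phi>"
  shows "fp_act M A act"
proof -
  obtain X :: "nat set" and R \<psi> where "finite X" "finite R" "presentation M X R"
    and "act_iso M A' act' (free_carrier M X // pres_cong M X R)
           (quot_op (free_op M) (pres_cong M X R)) \<psi>"
    using assms(1) unfolding fp_act_def defined_by_def by blast
  then show ?thesis
    using act_iso_comp[OF assms(2)] unfolding fp_act_def defined_by_def by blast
qed

lemma fp_act_any_type:
  fixes M :: "('m, 'r) monoid_scheme" and X :: "'x set"
  assumes M: "monoid M" and fin: "finite X" "finite R" and "defined_by M A act X R"
  shows "fp_act M A act"
proof -
  obtain \<psi> where X: "X \<noteq> {}" and R: "R \<subseteq> free_carrier M X \<times> free_carrier M X"
    and \<psi>: "act_iso M A act (free_carrier M X // pres_cong M X R)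
              (quot_op (free_op M) (pres_cong M X R)) \<psi>"
    using assms(4) unfolding defined_by_def presentation_def by blast
  obtain f :: "'x \<Rightarrow> nat" where f: "inj_on f X"
    using fin(1) finite_imp_inj_to_nat_seg by blast
  define \<phi> where "\<phi> = map_prod f (id :: 'm \<Rightarrow> 'm)"
  define R' where "R' = map_prod \<phi> \<phi> ` R"
  interpret monoid M by fact
  have iso: "act_iso M (free_carrier M X) (free_op M) (free_carrier M (f ` X)) (free_op M) \<phi>"
    using map_prod_inj_on[OF f inj_on_id] map_prod_surj_on[OF refl image_id[THEN fun_cong]]
    unfolding act_iso_def bij_betw_def \<phi>_def free_carrier_def free_op_def id_def by auto
  have F: "right_act M (free_carrier M X) (free_op M)"
    and F': "right_act M (free_carrier M (f ` X)) (free_op M)"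
    by (rule right_act_free[OF M], use X in simp)+
  have "act_iso M A act (free_carrier M (f ` X) // pres_cong M (f ` X) R')
          (quot_op (free_op M) (pres_cong M (f ` X) R')) ((`) \<phi> \<circ> \<psi>)"
    unfolding pres_cong_def R'_def
    by (rule act_iso_comp[OF \<psi>[unfolded pres_cong_def] quotient_iso[OF F F' iso R]])
  moreover have "presentation M (f ` X) R'"
    using X R unfolding presentation_def R'_def \<phi>_def free_carrier_def by force
  ultimately show ?thesis
    using fin unfolding fp_act_def defined_by_def R'_def by (meson finite_imageI)
qed

lemma right_coherent_any_type:
  assumes "right_coherent M" "right_act M A act" "fp_act M A act"
    and "subact M A act B" "fg_act M B act"
  shows "fp_act M B act"
proof -
  interpret right_act M A act by fact
  obtain X :: "nat set" and R \<phi> where X: "finite X" "finite R" "presentation M X R"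
    and iso: "act_iso M A act (free_carrier M X // pres_cong M X R)
            (quot_op (free_op M) (pres_cong M X R)) \<phi>"
    using assms(3) unfolding fp_act_def defined_by_def by blast
  define Q qop where "Q = free_carrier M X // pres_cong M X R"
    and "qop = quot_op (free_op M) (pres_cong M X R)"
  have F: "right_act M (free_carrier M X) (free_op M)"
    by (rule right_act_free[OF monoid_axioms]) (use X(3) in \<open>simp add: presentation_def\<close>)
  have Q: "right_act M Q qop"
    unfolding Q_def qop_def pres_cong_def
    by (rule right_act_quot[OF F act_congruence_gen(1)[OF F]])
      (use X(3) in \<open>simp add: presentation_def\<close>)
  have iso: "act_iso M A act Q qop \<phi>" using iso unfolding Q_def qop_def .
  have fpQ: "fp_act M Q qop" by (rule fp_act_iso[OF assms(3) act_iso_inv[OF iso assms(2)]])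
  have BA: "B \<subseteq> A" "B \<noteq> {}" "\<And>b m. b \<in> B \<Longrightarrow> m \<in> carrier M \<Longrightarrow> act b m \<in> B"
    using assms(4) unfolding subact_def by auto
  have b: "bij_betw \<phi> A Q" and e: "\<And>a m. a \<in> A \<Longrightarrow> m \<in> carrier M \<Longrightarrow> \<phi> (act a m) = qop (\<phi> a) m"
    using iso unfolding act_iso_def by auto
  have e': "\<And>a m. a \<in> B \<Longrightarrow> m \<in> carrier M \<Longrightarrow> qop (\<phi> a) m = \<phi> (act a m)"
    using e BA(1) by force
  have isoB: "act_iso M B act (\<phi> ` B) qop \<phi>"
    using b BA(1) e' unfolding act_iso_def bij_betw_def by (auto intro: inj_on_subset)
  have sub: "subact M Q qop (\<phi> ` B)"
    using b BA e' unfolding subact_def bij_betw_def by auto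
  obtain U where U: "finite U" "U \<subseteq> B" "\<forall>a\<in>B. \<exists>u\<in>U. \<exists>m\<in>carrier M. a = act u m"
    using assms(5) unfolding fg_act_def generates_act_def by blast
  have "\<exists>u\<in>\<phi> ` U. \<exists>m\<in>carrier M. \<phi> a = qop u m" if a: "a \<in> B" for a
  proof -
    obtain u m where u: "u \<in> U" and m: "m \<in> carrier M" and "a = act u m" using U(3) a by blast
    then have "\<phi> a = qop (\<phi> u) m" using e'[of u m] U(2) by auto
    then show ?thesis using u m by blast
  qed
  then have "generates_act M (\<phi> ` B) qop (\<phi> ` U)"
    using U(2) unfolding generates_act_def by blast
  then have "fg_act M (\<phi> ` B) qop" using U(1) unfolding fg_act_def by blast
  then have "fp_act M (\<phi> ` B) qop"
    using assms(1) Q fpQ sub unfolding right_coherent_def by blast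
  then show ?thesis using isoB by (rule fp_act_iso)
qed

end

theory Submission
  imports Defs
begin

text \<open>By coherence it suffices that \<open>B\<close> is finitely generated. Let \<open>U\<close> and \<open>S\<close> be finite
  generating sets of \<open>A\<close> and \<open>M\<close>. Following an element \<open>u s\<^sub>1 s\<^sub>2 \<dots> s\<^sub>k\<close> of \<open>B\<close> from left to
  right, one enters \<open>B\<close> either at \<open>u\<close> itself or by a step from some \<open>a \<in> A - B\<close> to
  \<open>a s \<in> B\<close> with \<open>s \<in> S\<close>. Hence the finite set of entry points, \<open>U \<inter> B\<close> together with all
  such \<open>a s\<close>, generates \<open>B\<close>.\<close>

text \<open>In a quotient of a free act the classes of the pairs \<open>(x, \<one>)\<close>
  generate; a finite presentation has only finitely many of these, and an isomorphism carries them
  over to \<open>A\<close>.\<close>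

lemma fp_act_imp_fg_act:
  assumes "right_act M A act" "fp_act M A act"
  shows "fg_act M A act"
proof -
  interpret right_act M A act by fact
  obtain X :: "nat set" and R \<phi> where X: "finite X" "presentation M X R"
    and iso: "act_iso M A act (free_carrier M X // pres_cong M X R)
            (quot_op (free_op M) (pres_cong M X R)) \<phi>"
    using assms(2) unfolding fp_act_def defined_by_def by blast
  define F \<rho> where "F = free_carrier M X" and "\<rho> = pres_cong M X R"
  have "right_act M F (free_op M)"
    unfolding F_def
    by (rule right_act_free[OF monoid_axioms]) (use X(2) in \<open>simp add: presentation_def\<close>)
  moreover have "R \<subseteq> F \<times> F" using X(2) by (simp add: presentation_def F_def)
  ultimately have cong: "act_congruence M F (free_op M) \<rho>"
    unfolding \<rho>_def pres_cong_def F_def[symmetric] by (rule act_congruence_gen(1))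
  define g where "g = inv_into A \<phi>"
  have inv: "act_iso M (F // \<rho>) (quot_op (free_op M) \<rho>) A act g"
    unfolding g_def F_def \<rho>_def by (rule act_iso_inv[OF iso assms(1)])
  then have g: "g ` (F // \<rho>) = A"
    and hom: "\<And>C m. C \<in> F // \<rho> \<Longrightarrow> m \<in> carrier M \<Longrightarrow> g (quot_op (free_op M) \<rho> C m) = act (g C) m"
    unfolding act_iso_def bij_betw_def by auto
  define U where "U = (\<lambda>x. g (\<rho> `` {(x, \<one>\<^bsub>M\<^esub>)})) ` X"
  have free: "(x, m) \<in> F" if "x \<in> X" "m \<in> carrier M" for x m
    using that by (simp add: F_def free_carrier_def)
  have "generates_act M A act U"
    unfolding generates_act_def
  proof (intro conjI ballI)
    show "U \<subseteq> A"
      using g free quotientI[of _ F \<rho>] by (auto simp: U_def)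
  next
    fix a assume "a \<in> A"
    then obtain C where C: "C \<in> F // \<rho>" "a = g C" using g by blast
    then obtain x m where xm: "x \<in> X" "m \<in> carrier M" and C': "C = \<rho> `` {(x, m)}"
      by (auto elim!: quotientE simp: F_def free_carrier_def)
    \<comment> \<open>In the free act \<open>(x, m)\<close> is \<open>(x, \<one>)\<close> acted on
      by \<open>m\<close>.\<close>
    have "C = quot_op (free_op M) \<rho> (\<rho> `` {(x, \<one>\<^bsub>M\<^esub>)}) m"
      using quot_op_class[OF cong free[OF xm(1) one_closed] xm(2)] xm(2)
      by (simp add: C' free_op_def)
    then have "a = act (g (\<rho> `` {(x, \<one>\<^bsub>M\<^esub>)})) m"
      using C(2) hom xm(2) quotientI[OF free[OF xm(1) one_closed]] by simp
    then show "\<exists>u\<in>U. \<exists>m\<in>carrier M. a = act u m"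
      using xm unfolding U_def by blast
  qed
  then show ?thesis using X(1) unfolding fg_act_def U_def by blast
qed

lemma large_subact_fg_act:
  assumes "fg_monoid M" "right_act M A act" "large_subact M A act B" "fg_act M A act"
  shows "fg_act M B act"
proof -
  interpret right_act M A act by fact
  obtain S where S: "finite S" "S \<subseteq> carrier M"
    and gen: "\<And>H. submonoid H M \<Longrightarrow> S \<subseteq> H \<Longrightarrow> H = carrier M"
    using assms(1) unfolding fg_monoid_def by blast
  obtain U where U: "finite U" "U \<subseteq> A" "\<And>a. a \<in> A \<Longrightarrow> \<exists>u\<in>U. \<exists>m\<in>carrier M. a = act u m"
    using assms(4) unfolding fg_act_def generates_act_def by blast
  have B: "B \<subseteq> A" "finite (A - B)"
    using assms(3) unfolding large_subact_def subact_def by auto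
  define V where "V = (U \<inter> B) \<union> ((\<lambda>(a, s). act a s) ` ((A - B) \<times> S) \<inter> B)"
  have V: "finite V" "V \<subseteq> B"
    using U(1) S(1) B(2) unfolding V_def by auto
  \<comment> \<open>The elements whose action from outside \<open>B\<close> can end in
    \<open>B\<close> only at points generated by \<open>V\<close>. Showing that they form a
    submonoid containing \<open>S\<close> replaces induction on the length of a word in
    \<open>S\<close>.\<close>
  define H where "H = {m \<in> carrier M. \<forall>a\<in>A - B. act a m \<in> B \<longrightarrow>
    (\<exists>v\<in>V. \<exists>n\<in>carrier M. act a m = act v n)}"
  have "submonoid H M"
  proof
    show "H \<subseteq> carrier M" by (auto simp: H_def)
    \<comment> \<open>Vacuous: \<open>\<one>\<close> fixes \<open>a\<close>, which lies outside
      \<open>B\<close>.\<close>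
    show "\<one>\<^bsub>M\<^esub> \<in> H" by (auto simp: H_def act_one)
  next
    fix m n assume mn: "m \<in> H" "n \<in> H"
    then have c: "m \<in> carrier M" "n \<in> carrier M" by (auto simp: H_def)
    have "\<exists>v\<in>V. \<exists>k\<in>carrier M. act a (m \<otimes>\<^bsub>M\<^esub> n) = act v k"
      if a: "a \<in> A - B" and ab: "act a (m \<otimes>\<^bsub>M\<^esub> n) \<in> B" for a
    proof (cases "act a m \<in> B")
      \<comment> \<open>\<open>B\<close> is already reached after \<open>m\<close>, so the witness
        for \<open>m\<close> only has to be extended by \<open>n\<close>.\<close>
      case True
      then obtain v k where v: "v \<in> V" "k \<in> carrier M" "act a m = act v k"
        using mn(1) a unfolding H_def by blast
      then have "act a (m \<otimes>\<^bsub>M\<^esub> n) = act v (k \<otimes>\<^bsub>M\<^esub> n)"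
        using a c V(2) B(1) act_mult by auto
      then show ?thesis using v c by blast
    next
      case False
      \<comment> \<open>The entry into \<open>B\<close> happens during \<open>n\<close>, so the
        property of \<open>n\<close> is applied at the point \<open>act a m\<close>.\<close>
      then have "act a m \<in> A - B" using a c act_closed by blast
      then show ?thesis
        using mn(2) a ab c act_mult unfolding H_def by auto
    qed
    then show "m \<otimes>\<^bsub>M\<^esub> n \<in> H" using c by (simp add: H_def)
  qed
  moreover have "S \<subseteq> H"
  proof
    fix s assume s: "s \<in> S"
    have "\<exists>v\<in>V. \<exists>n\<in>carrier M. act a s = act v n" if a: "a \<in> A - B" "act a s \<in> B" for a
    proof
      \<comment> \<open>A single generator leads straight to an entry point, which serves as its own
        witness with \<open>n\<close> equal to \<open>\<one>\<close>.\<close>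
      show "act a s \<in> V" using a s unfolding V_def by blast
      show "\<exists>n\<in>carrier M. act a s = act (act a s) n"
        using act_one[of "act a s"] a(2) B(1) by force
    qed
    then show "s \<in> H" using s S(2) by (auto simp: H_def)
  qed
  ultimately have H: "H = carrier M" by (rule gen)
  have "\<exists>v\<in>V. \<exists>n\<in>carrier M. b = act v n" if b: "b \<in> B" for b
  proof -
    obtain u m where u: "u \<in> U" "m \<in> carrier M" "b = act u m"
      using U(3) B(1) b by blast
    show ?thesis
    proof (cases "u \<in> B")
      case True
      then show ?thesis using u unfolding V_def by blast
    next
      case False
      \<comment> \<open>Here \<open>u\<close> lies in \<open>A - B\<close> and \<open>m\<close> in
        \<open>H\<close>, so the defining property of \<open>H\<close> applies to
        \<open>act u m\<close>.\<close>
      then show ?thesis using u U(2) b H unfolding H_def by blast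
    qed
  qed
  then show ?thesis using V unfolding fg_act_def generates_act_def by blast
qed

theorem lemma6p13:
  fixes M :: "('m, 'r) monoid_scheme"
    and A B :: "'a set"
    and act :: "'a \<Rightarrow> 'm \<Rightarrow> 'a"
  assumes "monoid M"
    and "fg_monoid M"
    and "right_coherent M"
    and "right_act M A act"
    and "large_subact M A act B"
    and "fp_act M A act"
  shows "fp_act M B act"
\<comment> \<open>\<open>right_coherent\<close> speaks of acts with elements in one fixed type; its
  transferred form covers the type \<open>'a\<close>.\<close>
proof (rule right_coherent_any_type)
  show "subact M A act B" using assms(5) by (simp add: large_subact_def)
  show "fg_act M B act"
    by (rule large_subact_fg_act[OF assms(2,4,5) fp_act_imp_fg_act[OF assms(4,6)]])
qed (fact assms)+

end
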